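(* For integers $n\ge1$ and $1\le r\le n$, the number of partitions of $n$ whose $x$-ray list has length $r$ equals the number of partitions of $n$ that are maximally contained in the staircase $\delta_r$.
   Context: For a partition $\lambda$ with $\ell(\lambda)$ parts, let $m=\max\{\lambda_1,\ell(\lambda)\}$ and let the Ferrers matrix of $\lambda$ be the $m\times m$ $0/1$ matrix whose $(i,j)$ entry is $1$ if $j\le\lambda_i$ and $0$ otherwise. The $x$-ray list $\lambda_x$ is the sequence of anti-diagonal sums $(s_2,\dots,s_{2m})$, $s_k=\sum_{i+j=k}$ (entries of the Ferrers matrix); its length is its number of nonzero entries. The staircase partition is $\delta_r=(r,r-1,\dots,1)$. A partition $\mu$ is contained in $\eta$ if $\mu_i\le\eta_i$ for all $i$ (padding with zeros), and $\lambda$ is maximally contained in $\delta_r$ if it is contained in $\delta_r$ but not in $\delta_{r-1}$. *)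

theory Defs
  imports Main "Jordan_Normal_Form.Matrix"
begin

definition partitions_of :: "nat \<Rightarrow> nat list set" where
  "partitions_of n = {xs. sorted_wrt (\<ge>) xs \<and> 0 \<notin> set xs \<and> sum_list xs = n}"

text \<open>The part \<open>\<lambda>\<^sub>i\<close>, counted from \<open>i = 1\<close> and padded with zeros.\<close>

definition part :: "nat list \<Rightarrow> nat \<Rightarrow> nat" where
  "part xs i = (if 1 \<le> i \<and> i \<le> length xs then xs ! (i - 1) else 0)"

text \<open>Library matrices are indexed from 0, so the entry at \<open>(i, j)\<close> below is the
  entry at \<open>(i + 1, j + 1)\<close> in the usual numbering. The antidiagonal sums
  keep the usual numbering, with \<open>k\<close> ranging over \<open>2, \<dots>, 2m\<close>.\<close>

definition ferrers_matrix :: "nat list \<Rightarrow> nat mat" where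
  "ferrers_matrix xs =
    (let m = max (part xs 1) (length xs)
     in mat m m (\<lambda>(i, j). if Suc j \<le> part xs (Suc i) then 1 else 0))"

definition antidiagonal_sum :: "nat mat \<Rightarrow> nat \<Rightarrow> nat" where
  "antidiagonal_sum A k =
    (\<Sum>(i, j)\<in>{(i, j). i < dim_row A \<and> j < dim_col A \<and> Suc i + Suc j = k}. A $$ (i, j))"

definition xray_list :: "nat list \<Rightarrow> nat list" where
  "xray_list xs =
    map (antidiagonal_sum (ferrers_matrix xs)) [2..<2 * dim_row (ferrers_matrix xs) + 1]"

text \<open>The length of an x-ray list counts only its nonzero entries.\<close>

definition xray_length :: "nat list \<Rightarrow> nat" where
  "xray_length xs = length (filter (\<lambda>s. s \<noteq> 0) (xray_list xs))"

definition staircase :: "nat \<Rightarrow> nat list" where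
  "staircase r = rev [1..<r + 1]"

definition contained_in :: "nat list \<Rightarrow> nat list \<Rightarrow> bool" where
  "contained_in xs ys \<longleftrightarrow> (\<forall>i\<ge>1. part xs i \<le> part ys i)"

text \<open>Only meant for \<open>r \<ge> 1\<close>; for \<open>r = 1\<close> the smaller staircase is the empty partition.\<close>

definition maximally_contained :: "nat list \<Rightarrow> nat \<Rightarrow> bool" where
  "maximally_contained xs r \<longleftrightarrow>
    contained_in xs (staircase r) \<and> \<not> contained_in xs (staircase (r - 1))"

lemma finite_partitions_of: "finite (partitions_of n)"
proof (rule finite_subset)
  have len: "length xs \<le> sum_list xs" if "0 \<notin> set xs" for xs :: "nat list"
    using that by (induction xs) (auto simp: Suc_le_eq)
  show "partitions_of n \<subseteq> {xs. set xs \<subseteq> {..n} \<and> length xs \<le> n}"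
    using len by (auto simp: partitions_of_def member_le_sum_list)
  show "finite {xs. set xs \<subseteq> {..n} \<and> length xs \<le> n}"
    by (rule finite_lists_length_le) simp
qed

end

theory Submission
  imports Defs
begin

text \<open>
  The antidiagonals that meet a Ferrers diagram form an initial segment, so the length of the
  x-ray list is the index of the last antidiagonal met. A diagram lies in the staircase
  \<open>\<delta>\<^sub>r\<close> exactly when all its cells are on the first \<open>r\<close> antidiagonals.
  Hence the two sets of partitions coincide.
\<close>

text \<open>Cells are indexed from 0, as in \<^const>\<open>ferrers_matrix\<close>.\<close>

definition cells :: "nat list \<Rightarrow> (nat \<times> nat) set" where
  "cells xs = {(i, j). j < part xs (Suc i)}"

text \<open>The element \<open>d\<close> stands for the antidiagonal numbered \<open>d + 2\<close>
  in \<open>xray_list\<close>, since cells are indexed from 0.\<close>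

definition levels :: "nat list \<Rightarrow> nat set" where
  "levels xs = (\<lambda>(i, j). i + j) ` cells xs"

lemma part_mono:
  assumes "sorted_wrt (\<ge>) xs" and "1 \<le> i" and "i \<le> k"
  shows "part xs k \<le> part xs i"
  using assms by (cases "i = k") (auto simp: part_def sorted_wrt_iff_nth_less)

lemma cells_bounded:
  assumes "sorted_wrt (\<ge>) xs" and "(i, j) \<in> cells xs"
  shows "i < length xs" and "j < part xs 1"
proof -
  have j: "j < part xs (Suc i)"
    using assms(2) by (simp add: cells_def)
  then show "i < length xs"
    by (auto simp: part_def split: if_splits)
  show "j < part xs 1"
    using j part_mono[OF assms(1), of 1 "Suc i"] by simp
qed

lemma finite_levels:
  assumes "sorted_wrt (\<ge>) xs"
  shows "finite (levels xs)"
proof -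
  have "cells xs \<subseteq> {..<length xs} \<times> {..<part xs 1}"
    using cells_bounded[OF assms] by auto
  then show ?thesis
    unfolding levels_def by (blast intro: finite_subset)
qed

text \<open>From a cell on antidiagonal \<open>Suc d\<close>, move one step left, or one step up if
  it lies in column 0. The diagram is closed under both moves, the second because parts
  decrease.\<close>

lemma levels_pred:
  assumes "sorted_wrt (\<ge>) xs" and "Suc d \<in> levels xs"
  shows "d \<in> levels xs"
proof -
  obtain i j where ij: "j < part xs (Suc i)" "i + j = Suc d"
    using assms(2) by (auto simp: levels_def cells_def)
  show ?thesis
  proof (cases j)
    case 0
    then have "i = Suc d"
      using ij by simp
    then have "(d, 0) \<in> cells xs"
      using ij part_mono[OF assms(1), of "Suc d" "Suc i"] by (simp add: cells_def)
    then show ?thesis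
      by (force simp: levels_def)
  next
    case (Suc j')
    then have "(i, j') \<in> cells xs" "i + j' = d"
      using ij by (auto simp: cells_def)
    then show ?thesis
      by (force simp: levels_def)
  qed
qed

text \<open>Such a \<open>D\<close> is an initial segment of the naturals, so its cardinality is
  also its least strict upper bound. This links a count of antidiagonals to a bound on their
  indices.\<close>

lemma card_le_iff_subset_lessThan:
  fixes D :: "nat set"
  assumes "finite D" and pred: "\<And>d. Suc d \<in> D \<Longrightarrow> d \<in> D"
  shows "card D \<le> s \<longleftrightarrow> D \<subseteq> {..<s}"
proof
  assume "card D \<le> s"
  show "D \<subseteq> {..<s}"
  proof
    fix d assume "d \<in> D"
    \<comment> \<open>Downward induction from \<open>d\<close>, applying \<open>pred\<close> at each
      step.\<close>
    have "k \<in> D" if "k \<le> d" for k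
      using that \<open>d \<in> D\<close> by (induction rule: inc_induct) (auto intro: pred)
    then have "card {..d} \<le> card D"
      by (intro card_mono assms(1)) auto
    then show "d \<in> {..<s}"
      using \<open>card D \<le> s\<close> by simp
  qed
next
  assume "D \<subseteq> {..<s}"
  then show "card D \<le> s"
    using card_mono[of "{..<s}" D] by simp
qed

text \<open>The entries are natural numbers, so a sum vanishes only if each of its terms
  does.\<close>

lemma antidiagonal_sum_ferrers_eq_0_iff:
  assumes "sorted_wrt (\<ge>) xs"
  shows "antidiagonal_sum (ferrers_matrix xs) (d + 2) = 0 \<longleftrightarrow> d \<notin> levels xs"
proof -
  define m where "m = max (part xs 1) (length xs)"
  define A where "A = {(i, j). i < m \<and> j < m \<and> Suc i + Suc j = d + 2}"
  have "A \<subseteq> {..<m} \<times> {..<m}"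
    by (auto simp: A_def)
  then have fin: "finite A"
    by (rule finite_subset) simp
  have "antidiagonal_sum (ferrers_matrix xs) (d + 2) =
      (\<Sum>(i, j)\<in>A. ferrers_matrix xs $$ (i, j))"
    by (simp add: antidiagonal_sum_def ferrers_matrix_def A_def m_def Let_def)
  also have "\<dots> = (\<Sum>(i, j)\<in>A. if (i, j) \<in> cells xs then 1 else 0)"
    by (intro sum.cong)
      (auto simp: A_def m_def ferrers_matrix_def cells_def Let_def Suc_le_eq)
  finally have "antidiagonal_sum (ferrers_matrix xs) (d + 2) = 0 \<longleftrightarrow> A \<inter> cells xs = {}"
    using fin by (auto simp: sum_eq_0_iff)
  \<comment> \<open>The size \<open>m\<close> bounds both the row and the column indices of cells,
    so the matrix cuts off no cell.\<close>
  moreover have "A \<inter> cells xs = {(i, j) \<in> cells xs. i + j = d}"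
    using cells_bounded[OF assms] by (auto simp: A_def m_def less_max_iff_disj)
  ultimately show ?thesis
    by (auto simp: levels_def)
qed

lemma xray_length_eq_card_levels:
  assumes "sorted_wrt (\<ge>) xs"
  shows "xray_length xs = card (levels xs)"
proof -
  define m where "m = max (part xs 1) (length xs)"
  let ?P = "\<lambda>k. antidiagonal_sum (ferrers_matrix xs) k \<noteq> 0"
  have dim: "dim_row (ferrers_matrix xs) = m"
    by (simp add: ferrers_matrix_def m_def Let_def)
  \<comment> \<open>A cell has \<open>i\<close> and \<open>j\<close> at most \<open>m - 1\<close>,
    hence \<open>d + 2\<close> is at most \<open>2 * m\<close>, the last index in the x-ray
    list.\<close>
  have bound: "d + 2 < 2 * m + 1" if "d \<in> levels xs" for d
    using that cells_bounded[OF assms] by (fastforce simp: levels_def m_def)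
  have "xray_length xs = length (filter ?P [2..<2 * m + 1])"
    by (simp add: xray_length_def xray_list_def filter_map comp_def dim)
  also have "\<dots> = card (set (filter ?P [2..<2 * m + 1]))"
    by (rule distinct_card[symmetric]) simp
  also have "set (filter ?P [2..<2 * m + 1]) = (\<lambda>d. d + 2) ` levels xs"
  proof (intro equalityI subsetI)
    fix k assume "k \<in> set (filter ?P [2..<2 * m + 1])"
    then have "2 \<le> k" "?P k"
      by auto
    then obtain d where "k = d + 2"
      by (metis le_add_diff_inverse2)
    then have "d \<in> levels xs"
      using \<open>?P k\<close> antidiagonal_sum_ferrers_eq_0_iff[OF assms, of d] by metis
    then show "k \<in> (\<lambda>d. d + 2) ` levels xs"
      using \<open>k = d + 2\<close> by blast
  next
    fix k assume "k \<in> (\<lambda>d. d + 2) ` levels xs"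
    then obtain d where "k = d + 2" "d \<in> levels xs"
      by blast
    then have "?P k" "2 \<le> k" "k < 2 * m + 1"
      using bound[of d] antidiagonal_sum_ferrers_eq_0_iff[OF assms, of d] by simp_all
    then show "k \<in> set (filter ?P [2..<2 * m + 1])"
      by (simp only: set_filter set_upt) simp
  qed
  also have "card \<dots> = card (levels xs)"
    by (rule card_image) (simp add: inj_on_def)
  finally show ?thesis .
qed

text \<open>Below the last row, truncated subtraction gives 0, in agreement with the zero padding in
  \<open>part\<close>.\<close>

lemma part_staircase: "1 \<le> i \<Longrightarrow> part (staircase s) i = Suc s - i"
  by (auto simp: part_def staircase_def rev_nth nth_append simp del: upt_Suc)

lemma contained_in_staircase_iff: "contained_in xs (staircase s) \<longleftrightarrow> levels xs \<subseteq> {..<s}"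
proof -
  have "contained_in xs (staircase s) \<longleftrightarrow> (\<forall>i. part xs (Suc i) \<le> s - i)"
    unfolding contained_in_def
    by (metis One_nat_def Suc_le_D Suc_le_mono diff_Suc_Suc le0 part_staircase)
  \<comment> \<open>A bound on a row length is tested cell by cell: \<open>j < s - i\<close> means
    \<open>i + j < s\<close>, and both fail once \<open>i\<close> reaches \<open>s\<close>.\<close>
  also have "\<dots> \<longleftrightarrow> (\<forall>i j. j < part xs (Suc i) \<longrightarrow> i + j < s)"
    by (metis add.commute less_diff_conv not_less order.strict_trans2 less_irrefl)
  also have "\<dots> \<longleftrightarrow> levels xs \<subseteq> {..<s}"
    by (auto simp: levels_def cells_def)
  finally show ?thesis .
qed

text \<open>Containment becomes a threshold on a single number, so maximal containment can pin that
  number down.\<close>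

lemma contained_in_staircase_iff_xray_length:
  assumes "sorted_wrt (\<ge>) xs"
  shows "contained_in xs (staircase s) \<longleftrightarrow> xray_length xs \<le> s"
  unfolding contained_in_staircase_iff xray_length_eq_card_levels[OF assms]
  using card_le_iff_subset_lessThan[OF finite_levels[OF assms] levels_pred[OF assms]] by simp

theorem theorem6p7:
  fixes n r :: nat
  assumes "1 \<le> n" and "1 \<le> r" and "r \<le> n"
  shows "card {xs \<in> partitions_of n. xray_length xs = r} =
         card {xs \<in> partitions_of n. maximally_contained xs r}"
proof -
  \<comment> \<open>Maximal containment says that the length is at most \<open>r\<close> but not at
    most \<open>r - 1\<close>. Since \<open>1 \<le> r\<close>, the subtraction is genuine and the
    length equals \<open>r\<close>.\<close>
  have "xray_length xs = r \<longleftrightarrow> maximally_contained xs r" if "xs \<in> partitions_of n" for xs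
    using that assms(2)
    by (auto simp: partitions_of_def maximally_contained_def contained_in_staircase_iff_xray_length)
  then show ?thesis
    by (metis (mono_tags, lifting) Collect_cong)
qed

end
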